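(* Let $T$ be a tree and let $ab$, $cd$ be two non-incident edges of $T$ (so $a,b,c,d$ are distinct). The 2-switch $\tau=\binom{a\ b}{c\ d}$ is a t-switch over $T$ if and only if either the unique path in $T$ from $a$ to $d$ has the form $(a\,b\ldots c\,d)$ (i.e., its second vertex is $b$ and its penultimate vertex is $c$), or the unique path in $T$ from $b$ to $c$ has the form $(b\,a\ldots d\,c)$ (i.e., its second vertex is $a$ and its penultimate vertex is $d$).
   Context: Graphs are finite, simple, undirected and labeled. For vertices $a,b,c,d$ and a graph $G$, the matrix $\binom{a\ b}{c\ d}$ is interchangeable in $G$ if $ab,cd\in E(G)$, $\{a,b\}\cap\{c,d\}=\varnothing$ and $ac,bd\notin E(G)$; otherwise trivial. The 2-switch $\tau=\binom{a\ b}{c\ d}$ maps $G$ to $G-ab-cd+ac+bd$ if the matrix is interchangeable in $G$, and to $G$ otherwise; it is nontrivial for $G$ if the matrix is interchangeable in $G$. A nontrivial 2-switch $\tau$ over a tree $T$ is called a t-switch if $\tau(T)$ is a tree. *)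

theory Defs
  imports "Graph_Theory.Graph_Theory"
begin

text \<open>
  A finite simple undirected graph is a \<open>pair_graph\<close>: an edge \<open>uv\<close> is represented by the two
  arcs \<open>(u, v)\<close> and \<open>(v, u)\<close>.
\<close>

definition del_edge :: "'a \<Rightarrow> 'a \<Rightarrow> 'a pair_pre_digraph \<Rightarrow> 'a pair_pre_digraph" where
  "del_edge u v G = G\<lparr>parcs := parcs G - {(u, v), (v, u)}\<rparr>"

definition add_edge :: "'a \<Rightarrow> 'a \<Rightarrow> 'a pair_pre_digraph \<Rightarrow> 'a pair_pre_digraph" where
  "add_edge u v G = G\<lparr>parcs := parcs G \<union> {(u, v), (v, u)}\<rparr>"

text \<open>
  The library predicate \<open>tree\<close> is not usable for symmetric digraphs: it also forbids the closed
  walks \<open>u v u\<close> of length 2, which exist along every undirected edge. The cycles of an undirected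
  simple graph are the directed cycles with at least three arcs.
\<close>

definition undirected_tree :: "'a pair_pre_digraph \<Rightarrow> bool" where
  "undirected_tree G \<longleftrightarrow> pair_graph G \<and> Digraph_Component.connected (with_proj G) \<and>
     \<not> (\<exists>p. pre_digraph.cycle (with_proj G) p \<and> 3 \<le> length p)"

text \<open>
  A path is the list of its vertices. The description is proper when \<open>G\<close> is a tree and
  \<open>u\<close>, \<open>v\<close> are vertices of \<open>G\<close>.
\<close>

definition the_path :: "'a pair_pre_digraph \<Rightarrow> 'a \<Rightarrow> 'a \<Rightarrow> 'a list" where
  "the_path G u v = (THE p. vpath p (with_proj G) \<and> hd p = u \<and> last p = v)"

text \<open>In the following, \<open>a b c d\<close> are the entries of the matrix with rows \<open>a b\<close> and \<open>c d\<close>.\<close>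

definition interchangeable :: "'a \<Rightarrow> 'a \<Rightarrow> 'a \<Rightarrow> 'a \<Rightarrow> 'a pair_pre_digraph \<Rightarrow> bool" where
  "interchangeable a b c d G \<longleftrightarrow>
     (a, b) \<in> parcs G \<and> (c, d) \<in> parcs G \<and> {a, b} \<inter> {c, d} = {} \<and>
     (a, c) \<notin> parcs G \<and> (b, d) \<notin> parcs G"

definition two_switch ::
  "'a \<Rightarrow> 'a \<Rightarrow> 'a \<Rightarrow> 'a \<Rightarrow> 'a pair_pre_digraph \<Rightarrow> 'a pair_pre_digraph" where
  "two_switch a b c d G =
     (if interchangeable a b c d G
      then add_edge b d (add_edge a c (del_edge c d (del_edge a b G)))
      else G)"

definition t_switch :: "'a \<Rightarrow> 'a \<Rightarrow> 'a \<Rightarrow> 'a \<Rightarrow> 'a pair_pre_digraph \<Rightarrow> bool" where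
  "t_switch a b c d T \<longleftrightarrow>
     undirected_tree T \<and> interchangeable a b c d T \<and> undirected_tree (two_switch a b c d T)"

end

theory Submission
  imports Defs
begin

text \<open>
  Deleting the edges \<open>ab\<close> and \<open>cd\<close> leaves a forest \<open>F\<close> in which every vertex is joined to one of
  \<open>a\<close>, \<open>b\<close>, \<open>c\<close>, \<open>d\<close>, while neither \<open>a\<close>, \<open>b\<close> nor \<open>c\<close>, \<open>d\<close> are joined. As \<open>T\<close> is connected, some
  entry of the first row is joined to some entry of the second one. The new edge \<open>ac\<close> can only be
  a bridge if \<open>a\<close>, \<open>c\<close> are not joined in \<open>F\<close>, and likewise for \<open>bd\<close>; hence a t-switch forces \<open>b\<close>,
  \<open>c\<close> or \<open>a\<close>, \<open>d\<close> to be joined in \<open>F\<close>. Conversely, in these cases \<open>ac\<close> and \<open>bd\<close> reconnect the three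
  components of \<open>F\<close>, each of them joining two different components, so that no cycle arises. Finally,
  \<open>b\<close> and \<open>c\<close> are joined in \<open>F\<close> iff the path of \<open>T\<close> from \<open>a\<close> to \<open>d\<close> is \<open>a b \<dots> c d\<close>.
\<close>

section \<open>Reachability and bridges in a relation\<close>

abbreviation edge :: "'a \<Rightarrow> 'a \<Rightarrow> 'a rel" where
  "edge u v \<equiv> {(u, v), (v, u)}"

text \<open>For symmetric loop-free relations this means that there is no cycle of length at least three.\<close>

definition all_bridges :: "'a rel \<Rightarrow> bool" where
  "all_bridges E \<longleftrightarrow> (\<forall>(u, v) \<in> E. (u, v) \<notin> (E - edge u v)\<^sup>*)"

text \<open>One traversal of the new edge suffices: a second one leads back to a vertex that was
  already reached with at most one.\<close>

lemma rtrancl_Un_edge: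
  "(x, y) \<in> (F \<union> edge u v)\<^sup>* \<longleftrightarrow>
    (x, y) \<in> F\<^sup>* \<or> (x, u) \<in> F\<^sup>* \<and> (v, y) \<in> F\<^sup>* \<or> (x, v) \<in> F\<^sup>* \<and> (u, y) \<in> F\<^sup>*"
  (is "?L \<longleftrightarrow> ?R y")
proof
  assume ?L
  then show "?R y"
  proof (induction rule: rtrancl_induct)
    case base
    then show ?case by simp
  next
    case (step y z)
    show ?case
    proof (cases "(y, z) \<in> F")
      case True
      then show ?thesis using step.IH by (meson rtrancl.rtrancl_into_rtrancl)
    next
      case False
      then have "(y, z) = (u, v) \<or> (y, z) = (v, u)" using step.hyps by auto
      then show ?thesis using step.IH by auto
    qed
  qed
next
  have F: "F\<^sup>* \<subseteq> (F \<union> edge u v)\<^sup>*" by (rule rtrancl_mono) auto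
  have "(u, v) \<in> (F \<union> edge u v)\<^sup>*" "(v, u) \<in> (F \<union> edge u v)\<^sup>*" by auto
  moreover assume "?R y"
  ultimately show ?L using F by (meson rtrancl_trans subsetD)
qed

lemma sym_rtranclD: "sym E \<Longrightarrow> (x, y) \<in> E\<^sup>* \<Longrightarrow> (y, x) \<in> E\<^sup>*"
  by (meson sym_rtrancl symD)

lemma all_bridges_mono:
  assumes "all_bridges E" "F \<subseteq> E"
  shows "all_bridges F"
proof -
  have "(F - edge u v)\<^sup>* \<subseteq> (E - edge u v)\<^sup>*" for u v
    using assms(2) by (intro rtrancl_mono) auto
  then show ?thesis using assms unfolding all_bridges_def by blast
qed

lemma all_bridgesD:
  assumes "all_bridges E" "(u, v) \<in> E" "F \<subseteq> E - edge u v"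
  shows "(u, v) \<notin> F\<^sup>*"
  using assms rtrancl_mono[OF assms(3)] unfolding all_bridges_def by blast

text \<open>The new edge is a bridge because \<open>F\<close> does not join its ends. If an old edge
  \<open>xy\<close> stopped being one, the detour around it would run through \<open>uv\<close>, and
  replacing \<open>uv\<close> in that closed walk by its complement would join \<open>u\<close> and
  \<open>v\<close> inside \<open>F\<close>.\<close>

lemma all_bridges_Un_edge:
  assumes "all_bridges F" "sym F" "(u, v) \<notin> F\<^sup>*"
  shows "all_bridges (F \<union> edge u v)"
  unfolding all_bridges_def
proof (intro ballI, clarify)
  fix x y
  assume xy: "(x, y) \<in> F \<union> edge u v" and *: "(x, y) \<in> (F \<union> edge u v - edge x y)\<^sup>*"
  show False
  proof (cases "(x, y) \<in> edge u v")
    case True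
    then have "F \<union> edge u v - edge x y \<subseteq> F" by auto
    from rtrancl_mono[OF this] * have "(x, y) \<in> F\<^sup>*" by (rule subsetD)
    then show False using True assms(3) sym_rtranclD[OF assms(2)] by blast
  next
    case False
    let ?S = "F - edge x y"
    have F: "(x, y) \<in> F" "(y, x) \<in> F" using False xy assms(2) by (auto dest: symD)
    have "F \<union> edge u v - edge x y \<subseteq> ?S \<union> edge u v" by auto
    from rtrancl_mono[OF this] * have "(x, y) \<in> (?S \<union> edge u v)\<^sup>*" by (rule subsetD)
    moreover have "(x, y) \<notin> ?S\<^sup>*" using assms(1) F(1) by (rule all_bridgesD) simp
    ultimately have "(x, u) \<in> ?S\<^sup>* \<and> (v, y) \<in> ?S\<^sup>* \<or> (x, v) \<in> ?S\<^sup>* \<and> (u, y) \<in> ?S\<^sup>*"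
      unfolding rtrancl_Un_edge by blast
    moreover have "?S\<^sup>* \<subseteq> F\<^sup>*" by (rule rtrancl_mono) auto
    ultimately have "(x, u) \<in> F\<^sup>* \<and> (v, y) \<in> F\<^sup>* \<or> (x, v) \<in> F\<^sup>* \<and> (u, y) \<in> F\<^sup>*" by blast
    then have "(u, v) \<in> F\<^sup>*"
    proof
      assume "(x, u) \<in> F\<^sup>* \<and> (v, y) \<in> F\<^sup>*"
      then have "(u, x) \<in> F\<^sup>*" "(y, v) \<in> F\<^sup>*" using sym_rtranclD[OF assms(2)] by blast+
      from rtrancl_into_rtrancl[OF this(1) F(1)] this(2) show ?thesis by (rule rtrancl_trans)
    next
      assume "(x, v) \<in> F\<^sup>* \<and> (u, y) \<in> F\<^sup>*"
      then have "(u, y) \<in> F\<^sup>*" "(x, v) \<in> F\<^sup>*" by blast+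
      from rtrancl_into_rtrancl[OF this(1) F(2)] this(2) show ?thesis by (rule rtrancl_trans)
    qed
    then show False using assms(3) by simp
  qed
qed

section \<open>Walks and paths as vertex lists\<close>

lemma distinct_vwalk_arcs_last:
  assumes "distinct p"
  shows "(last p, x) \<notin> set (vwalk_arcs p)"
  using assms
proof (induction p rule: vwalk_arcs.induct)
  case (3 y z xs)
  then show ?case using last_in_set[of "z # xs"] by auto
qed auto

text \<open>In a distinct list the head is the source of the first arc only. This keeps the closing
  edge of a long cycle off the rest of the cycle.\<close>

lemma distinct_vwalk_arcs_hd_last:
  assumes "distinct p" "(hd p, last p) \<in> set (vwalk_arcs p)"
  shows "length p = 2"
proof (cases p rule: vwalk_arcs.cases)
  case (3 y z xs)
  then have "last (z # xs) = z"
    using assms by (auto dest: arcs_in_vwalk_arcs)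
  then have "xs = []" using assms 3 last_in_set[of xs] by (auto split: if_splits)
  then show ?thesis using 3 by simp
qed (use assms in auto)

lemma vwalk_arcs_rtrancl:
  assumes "set (vwalk_arcs p) \<subseteq> E" "p \<noteq> []"
  shows "(hd p, last p) \<in> E\<^sup>*"
  using assms
  by (induction p rule: vwalk_arcs.induct) (auto intro: converse_rtrancl_into_rtrancl)

lemma rtrancl_obtain_distinct:
  assumes "(x, y) \<in> E\<^sup>*"
  obtains p where "distinct p" "p \<noteq> []" "hd p = x" "last p = y" "set (vwalk_arcs p) \<subseteq> E"
proof -
  \<comment> \<open>With all of \<open>UNIV\<close> as vertices, membership conditions are vacuous
    and the shortening of walks to paths applies to a bare relation.\<close>
  let ?G = "with_proj \<lparr>pverts = UNIV, parcs = E\<rparr>"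
  have "\<exists>p. vwalk p ?G \<and> hd p = x \<and> last p = y"
    using assms
  proof (induction rule: converse_rtrancl_induct)
    case base
    have "vwalk [y] ?G" by simp
    then show ?case by (metis list.sel(1) last.simps)
  next
    case (step x z)
    then obtain p where "vwalk p ?G" "hd p = z" "last p = y" by blast
    then have "vwalk (x # p) ?G" "hd (x # p) = x" "last (x # p) = y"
      using step.hyps by (auto intro!: vwalk_consI)
    then show ?case by blast
  qed
  then obtain p where "vpath p ?G" "hd p = x" "last p = y"
    by (metis vwalk_imp_ex_vpath)
  then show thesis using that[of p] by (simp add: vpath_def vwalk_def)
qed

text \<open>Where two paths with the same ends first diverge, the next edge of one could be bypassed
  by following the other to the common end and returning, so it would not be a bridge.\<close>

lemma distinct_walk_unique:
  assumes "all_bridges E" "sym E"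
    and "distinct p" "p \<noteq> []" "set (vwalk_arcs p) \<subseteq> E"
    and "distinct q" "q \<noteq> []" "set (vwalk_arcs q) \<subseteq> E"
    and "hd p = hd q" "last p = last q"
  shows "p = q"
  using assms(3-)
proof (induction p arbitrary: q)
  case Nil
  then show ?case by simp
next
  case (Cons u p)
  from Cons.prems(5,7) obtain q' where q: "q = u # q'" by (cases q) auto
  show ?case
  proof (cases "p = [] \<or> q' = []")
    case True
    moreover have "u \<notin> set p" "u \<notin> set q'" "last (u # p) = last (u # q')"
      using Cons.prems(1,4,8) q by simp_all
    ultimately have "p = []" "q' = []"
      using last_in_set[of p] last_in_set[of q'] by (metis last.simps)+
    then show ?thesis using q by simp
  next
    case False
    then have arcs: "set (vwalk_arcs p) \<subseteq> E" "set (vwalk_arcs q') \<subseteq> E"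
      "(u, hd p) \<in> E" "(u, hd q') \<in> E" and last: "last p = last q'"
      using Cons.prems q by auto
    have "hd p = hd q'"
    proof (rule ccontr)
      assume neq: "hd p \<noteq> hd q'"
      let ?E = "E - edge u (hd p)"
      have symE: "sym ?E" using assms(2) unfolding sym_def by blast
      \<comment> \<open>Neither tail meets \<open>u\<close> again, so both survive the removal of
        the edge from \<open>u\<close> to \<open>hd p\<close>.\<close>
      have "u \<notin> set p" "u \<notin> set q'" using Cons.prems q by auto
      then have "set (vwalk_arcs p) \<subseteq> ?E" "set (vwalk_arcs q') \<subseteq> ?E"
        using arcs by (auto dest: arcs_in_vwalk_arcs)
      then have "(hd p, last q') \<in> ?E\<^sup>*" "(hd q', last q') \<in> ?E\<^sup>*"
        using False vwalk_arcs_rtrancl[of p ?E] vwalk_arcs_rtrancl[of q' ?E] by (simp_all add: last)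
      from this(2) sym_rtranclD[OF symE this(1)] have "(hd q', hd p) \<in> ?E\<^sup>*"
        by (rule rtrancl_trans)
      moreover have "(u, hd q') \<in> ?E"
        using arcs neq \<open>u \<notin> set q'\<close> False by auto
      ultimately have "(u, hd p) \<in> ?E\<^sup>*"
        by (rule converse_rtrancl_into_rtrancl[rotated])
      then show False using all_bridgesD[OF assms(1) arcs(3), of ?E] by simp
    qed
    with Cons.prems(1,4) arcs(1,2) last False q have "p = q'"
      by (intro Cons.IH) simp_all
    then show ?thesis using q by simp
  qed
qed

section \<open>Cycles and trees in terms of reachability\<close>

lemma vwalk_arcs_pawalk_verts:
  "pcas u p v \<Longrightarrow> vwalk_arcs (pawalk_verts u p) = p \<and> hd (pawalk_verts u p) = u
    \<and> last (pawalk_verts u p) = v \<and> pawalk_verts u p \<noteq> []"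
  by (induction p arbitrary: u) auto

lemma pcas_vwalk_arcs:
  "p \<noteq> [] \<Longrightarrow> pcas (hd p) (vwalk_arcs p) (last p) \<and> pawalk_verts (hd p) (vwalk_arcs p) = p"
  by (induction p rule: vwalk_arcs.induct) auto

text \<open>A path between the ends of an edge that avoids this edge closes up to a cycle;
  conversely, a cycle minus one of its edges is such a path.\<close>

lemma (in pair_graph) no_long_cycle_iff_all_bridges:
  "\<not> (\<exists>p. cycle p \<and> 3 \<le> length p) \<longleftrightarrow> all_bridges (parcs G)"
proof
  assume no_cycle: "\<not> (\<exists>p. cycle p \<and> 3 \<le> length p)"
  show "all_bridges (parcs G)"
    unfolding all_bridges_def
  proof (intro ballI, clarify)
    fix u v
    assume uv: "(u, v) \<in> parcs G" and "(u, v) \<in> (parcs G - edge u v)\<^sup>*"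
    then obtain p where p: "distinct p" "p \<noteq> []" "hd p = u" "last p = v"
      "set (vwalk_arcs p) \<subseteq> parcs G - edge u v"
      by (meson rtrancl_obtain_distinct)
    have "u \<noteq> v" using uv by (auto dest: no_loops')
    \<comment> \<open>One vertex would give \<open>u = v\<close>, and two would use the removed
      edge.\<close>
    have "length p \<ge> 3"
    proof (cases p rule: vwalk_arcs.cases)
      case (3 x y xs)
      then show ?thesis using p by (cases xs) auto
    qed (use p \<open>u \<noteq> v\<close> in auto)
    let ?c = "(v, u) # vwalk_arcs p"
    have "awalk v ?c v"
      using p pcas_vwalk_arcs[of p] uv arcs_symmetric[OF uv] by (auto simp: awalk_def in_arcsD2)
    moreover have "distinct (tl (pawalk_verts v ?c))"
      using p pcas_vwalk_arcs[of p] by auto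
    ultimately have "cycle ?c" unfolding cycle_def by blast
    moreover have "length ?c \<ge> 3"
      using \<open>length p \<ge> 3\<close> by (simp flip: vwalk_length_def)
    ultimately show False using no_cycle by blast
  qed
next
  assume bridges: "all_bridges (parcs G)"
  show "\<not> (\<exists>p. cycle p \<and> 3 \<le> length p)"
  proof clarify
    fix c
    assume "cycle c" "3 \<le> length c"
    then obtain u where "awalk u c u" "distinct (tl (pawalk_verts u c))"
      by (auto simp: cycle_def)
    then obtain x p where c: "c = (u, x) # p" "(u, x) \<in> parcs G" "set p \<subseteq> parcs G" "pcas x p u"
      "distinct (pawalk_verts x p)"
      using \<open>3 \<le> length c\<close> by (cases c) (auto simp: awalk_def)
    let ?q = "pawalk_verts x p"
    have q: "vwalk_arcs ?q = p" "hd ?q = x" "last ?q = u" "?q \<noteq> []"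
      using vwalk_arcs_pawalk_verts[OF c(4)] by auto
    \<comment> \<open>\<open>p\<close> has at least two arcs and \<open>?q\<close> one vertex more
      than that; hence \<open>p\<close> cannot contain the arc from its first to its last
      vertex.\<close>
    have "length ?q \<ge> 3"
      using \<open>3 \<le> length c\<close> c(1) vwalk_length_simp[of ?q, unfolded vwalk_length_def] q(1) by simp
    then have "(x, u) \<notin> set p"
      using distinct_vwalk_arcs_hd_last[OF c(5)] q by auto
    moreover have "(u, x) \<notin> set p"
      using distinct_vwalk_arcs_last[OF c(5)] q by auto
    ultimately have "set (vwalk_arcs ?q) \<subseteq> parcs G - edge x u"
      using c q by auto
    then have "(x, u) \<in> (parcs G - edge x u)\<^sup>*"
      using vwalk_arcs_rtrancl q by metis
    then show False
      using all_bridgesD[OF bridges arcs_symmetric[OF c(2)], of "parcs G - edge x u"] by simp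
  qed
qed

lemma undirected_tree_iff:
  "undirected_tree G \<longleftrightarrow> pair_graph G \<and> pverts G \<noteq> {} \<and>
    (\<forall>u \<in> pverts G. \<forall>v \<in> pverts G. (u, v) \<in> (parcs G)\<^sup>*) \<and> all_bridges (parcs G)"
proof (cases "pair_graph G")
  case True
  then interpret pair_graph G .
  \<comment> \<open>Connectedness is strong connectedness of the symmetric closure, which is
    \<open>G\<close> itself.\<close>
  have "mk_symmetric (with_proj G) = G"
    by (intro pair_pre_digraph.equality)
      (auto simp: mk_symmetric_def arcs_symmetric intro: rev_bexI)
  then have "Digraph_Component.connected (with_proj G) \<longleftrightarrow> pverts G \<noteq> {} \<and>
      (\<forall>u \<in> pverts G. \<forall>v \<in> pverts G. (u, v) \<in> (parcs G)\<^sup>*)"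
    by (auto simp: connected_def strongly_connected_def reachable_conv)
  then show ?thesis
    using True no_long_cycle_iff_all_bridges unfolding undirected_tree_def by blast
qed (simp add: undirected_tree_def)

section \<open>Paths of a tree\<close>

lemma the_path_eqI:
  assumes "undirected_tree G" "distinct p" "p \<noteq> []" "set p \<subseteq> pverts G" "set (vwalk_arcs p) \<subseteq> parcs G"
  shows "the_path G (hd p) (last p) = p"
proof -
  have "pair_graph G" and bridges: "all_bridges (parcs G)"
    using assms(1) unfolding undirected_tree_iff by auto
  then interpret pair_graph G by simp
  have "sym (parcs G)" using arcs_symmetric by (auto intro: symI)
  show ?thesis
    unfolding the_path_def
  proof (rule the_equality)
    show "vpath p (with_proj G) \<and> hd p = hd p \<and> last p = last p"
      using assms(2-5) by (simp add: vpath_def vwalk_def)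
  next
    fix q
    assume "vpath q (with_proj G) \<and> hd q = hd p \<and> last q = last p"
    then have q: "distinct q" "q \<noteq> []" "set (vwalk_arcs q) \<subseteq> parcs G"
      and ends: "hd q = hd p" "last q = last p"
      by (simp_all add: vpath_def vwalk_def)
    show "q = p"
      using bridges \<open>sym (parcs G)\<close> q assms(2,3,5) ends by (rule distinct_walk_unique)
  qed
qed

lemma (in pair_wf_digraph) vwalk_arcs_in_verts:
  assumes "set (vwalk_arcs p) \<subseteq> parcs G" "p \<noteq> []" "hd p \<in> pverts G"
  shows "set p \<subseteq> pverts G"
  using assms
proof (induction p rule: vwalk_arcs.induct)
  case (3 x y xs)
  then have "y \<in> pverts G" using in_arcsD2[of x y] by simp
  then show ?case using 3 by simp
qed auto

lemma the_path_props:
  assumes "undirected_tree G" "u \<in> pverts G" "v \<in> pverts G"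
  shows "distinct (the_path G u v)" "set (vwalk_arcs (the_path G u v)) \<subseteq> parcs G"
proof -
  interpret pair_graph G using assms(1) by (simp add: undirected_tree_def)
  have "(u, v) \<in> (parcs G)\<^sup>*" using assms unfolding undirected_tree_iff by blast
  then obtain p where p: "distinct p" "p \<noteq> []" "hd p = u" "last p = v" "set (vwalk_arcs p) \<subseteq> parcs G"
    by (rule rtrancl_obtain_distinct)
  have "set p \<subseteq> pverts G"
    using p(2,3,5) assms(2) by (intro vwalk_arcs_in_verts) simp_all
  from the_path_eqI[OF assms(1) p(1,2) this p(5)] have eq: "the_path G u v = p"
    unfolding p(3,4) .
  show "distinct (the_path G u v)" "set (vwalk_arcs (the_path G u v)) \<subseteq> parcs G"
    unfolding eq by (fact p(1), fact p(5))
qed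

text \<open>The stretch from \<open>b\<close> to \<open>c\<close> of such a path avoids
  \<open>a\<close> and \<open>d\<close>, hence both deleted edges. Conversely, a path from
  \<open>b\<close> to \<open>c\<close> without these edges extends by \<open>a\<close> and
  \<open>d\<close> to a path of \<open>T\<close>, and paths of \<open>T\<close> are unique.\<close>

lemma the_path_form_iff:
  assumes "undirected_tree T" "(a, b) \<in> parcs T" "(c, d) \<in> parcs T" "{a, b} \<inter> {c, d} = {}"
  shows "(\<exists>q. the_path T a d = [a, b] @ q @ [c, d]) \<longleftrightarrow>
    (b, c) \<in> (parcs T - edge a b - edge c d)\<^sup>*" (is "?L \<longleftrightarrow> (b, c) \<in> ?F\<^sup>*")
proof -
  interpret pair_graph T using assms(1) by (simp add: undirected_tree_def)
  have bridges: "all_bridges (parcs T)" using assms(1) unfolding undirected_tree_iff by blast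
  have symF: "sym ?F" using arcs_symmetric by (auto intro!: symI)
  show ?thesis
  proof
    assume ?L
    then obtain q where "the_path T a d = [a, b] @ q @ [c, d]" by blast
    define p where "p = b # q @ [c]"
    with \<open>the_path T a d = _\<close> have eq: "the_path T a d = a # p @ [d]" by simp
    have "a \<in> pverts T" "d \<in> pverts T" using assms in_arcsD1 in_arcsD2 by blast+
    note path = the_path_props[OF assms(1) this, unfolded eq]
    from path(1) have "a \<notin> set p" "d \<notin> set p" by auto
    moreover have "set (vwalk_arcs p) \<subseteq> parcs T"
      using path(2) set_vwalk_arcs_append1[of p "[d]"] set_vwalk_arcs_cons[of "p @ [d]" a] by blast
    ultimately have "set (vwalk_arcs p) \<subseteq> ?F" by (auto dest: arcs_in_vwalk_arcs)
    from vwalk_arcs_rtrancl[OF this] show "(b, c) \<in> ?F\<^sup>*" by (simp add: p_def)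
  next
    assume bc: "(b, c) \<in> ?F\<^sup>*"
    then obtain p where p: "distinct p" "p \<noteq> []" "hd p = b" "last p = c" "set (vwalk_arcs p) \<subseteq> ?F"
      by (rule rtrancl_obtain_distinct)
    have reach: "(b, x) \<in> ?F\<^sup>* \<and> (x, c) \<in> ?F\<^sup>*" if x: "x \<in> set p" for x
    proof -
      from x obtain ys zs where eq: "p = ys @ x # zs" by (meson split_list)
      have "set (vwalk_arcs (ys @ [x])) \<subseteq> ?F" "set (vwalk_arcs (x # zs)) \<subseteq> ?F"
        using p(5) set_vwalk_arcs_append1[of "ys @ [x]" zs] set_vwalk_arcs_append2[of "x # zs" ys]
        unfolding eq by auto
      from vwalk_arcs_rtrancl[OF this(1)] vwalk_arcs_rtrancl[OF this(2)] show ?thesis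
        using p(3,4) unfolding eq by (auto simp: hd_append split: if_splits)
    qed
    \<comment> \<open>Every vertex on \<open>p\<close> is joined to \<open>b\<close> and
      \<open>c\<close> in \<open>?F\<close>; \<open>a\<close> or \<open>d\<close> on
      \<open>p\<close> would thus contradict that \<open>ab\<close> and \<open>cd\<close> are
      bridges.\<close>
    have "(a, b) \<notin> ?F\<^sup>*" "(c, d) \<notin> ?F\<^sup>*"
      by (rule all_bridgesD[OF bridges assms(2)], blast)
        (rule all_bridgesD[OF bridges assms(3)], blast)
    then have nin: "a \<notin> set p" "d \<notin> set p"
      using reach[of a] reach[of d] sym_rtranclD[OF symF, of b a] sym_rtranclD[OF symF, of d c]
      by blast+
    have "a \<noteq> d" using assms by auto
    \<comment> \<open>So \<open>b\<close> and \<open>c\<close> are separate entries of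
      \<open>p\<close>, as the required form demands.\<close>
    have "hd p \<noteq> last p" using p assms by auto
    obtain p' where p': "p = b # p'" using p by (cases p) auto
    with \<open>hd p \<noteq> last p\<close> obtain q where q: "p = b # q @ [c]"
      using p by (cases p' rule: rev_cases) auto
    have arcs: "set (vwalk_arcs (a # p @ [d])) \<subseteq> parcs T"
      using p assms by (auto simp: set_vwalk_arcs_snoc)
    have "set p \<subseteq> pverts T"
      using p in_arcsD2[OF assms(2)] by (intro vwalk_arcs_in_verts) auto
    then have "set (a # p @ [d]) \<subseteq> pverts T"
      using assms(2,3) by (simp add: wellformed')
    moreover have "distinct (a # p @ [d])" using nin p(1) \<open>a \<noteq> d\<close> by simp
    ultimately have "the_path T (hd (a # p @ [d])) (last (a # p @ [d])) = a # p @ [d]"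
      using arcs by (intro the_path_eqI assms(1)) simp_all
    then show ?L using q by auto
  qed
qed

section \<open>The switched graph\<close>

lemma pair_graph_add_edge:
  assumes "pair_graph G" "u \<in> pverts G" "v \<in> pverts G" "u \<noteq> v"
  shows "pair_graph (add_edge u v G)"
proof -
  interpret pair_graph G by fact
  have "sym (parcs G \<union> edge u v)" using arcs_symmetric by (auto intro!: symI)
  then show ?thesis
    using assms pair_finite_verts pair_finite_arcs in_arcsD1 in_arcsD2 no_loops'
    by unfold_locales (auto simp: add_edge_def symmetric_def)
qed

lemma pair_graph_del_edge:
  assumes "pair_graph G"
  shows "pair_graph (del_edge u v G)"
proof -
  interpret pair_graph G by fact
  have "sym (parcs G - edge u v)" using arcs_symmetric by (auto intro!: symI)
  then show ?thesis
    using pair_finite_verts pair_finite_arcs in_arcsD1 in_arcsD2 no_loops'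
    by unfold_locales (auto simp: del_edge_def symmetric_def)
qed

lemma t_switch_iff:
  assumes "undirected_tree T" "(a, b) \<in> parcs T" "(c, d) \<in> parcs T" "{a, b} \<inter> {c, d} = {}"
  defines "F \<equiv> parcs T - edge a b - edge c d"
  shows "t_switch a b c d T \<longleftrightarrow> (b, c) \<in> F\<^sup>* \<or> (a, d) \<in> F\<^sup>*"
proof -
  interpret pair_graph T using assms(1) by (simp add: undirected_tree_def)
  have conn: "\<And>u v. u \<in> pverts T \<Longrightarrow> v \<in> pverts T \<Longrightarrow> (u, v) \<in> (parcs T)\<^sup>*"
    and bridges: "all_bridges (parcs T)"
    using assms(1) unfolding undirected_tree_iff by blast+
  have verts: "a \<in> pverts T" "b \<in> pverts T" "c \<in> pverts T" "d \<in> pverts T"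
    using assms in_arcsD1 in_arcsD2 by blast+
  have symF: "sym F" unfolding F_def using arcs_symmetric by (auto intro!: symI)
  note trans = rtrancl_trans[of _ _ F] and sym = sym_rtranclD[OF symF]
  have T: "parcs T = F \<union> edge a b \<union> edge c d"
    unfolding F_def using assms arcs_symmetric by auto
  \<comment> \<open>Keeping the other edge makes this stronger than separation in \<open>F\<close>:
    it also excludes the route from \<open>a\<close> to \<open>b\<close> through \<open>d\<close>
    and \<open>c\<close>.\<close>
  have ab: "(a, b) \<notin> (F \<union> edge c d)\<^sup>*"
    by (rule all_bridgesD[OF bridges assms(2)]) (use assms(4) T F_def in auto)
  have cd: "(c, d) \<notin> (F \<union> edge a b)\<^sup>*"
    by (rule all_bridgesD[OF bridges assms(3)]) (use assms(4) T F_def in auto)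
  have reach: "(a, u) \<in> F\<^sup>* \<or> (b, u) \<in> F\<^sup>* \<or> (c, u) \<in> F\<^sup>* \<or> (d, u) \<in> F\<^sup>*" if "u \<in> pverts T" for u
    using conn[OF verts(1) that] unfolding T rtrancl_Un_edge by blast
  have cross: "(a, c) \<in> F\<^sup>* \<or> (b, c) \<in> F\<^sup>* \<or> (a, d) \<in> F\<^sup>* \<or> (b, d) \<in> F\<^sup>*"
    using conn[OF verts(1,3)] unfolding T rtrancl_Un_edge by blast
  define T' where "T' = add_edge b d (add_edge a c (del_edge c d (del_edge a b T)))"
  have T': "pverts T' = pverts T" "parcs T' = F \<union> edge a c \<union> edge b d"
    by (auto simp: T'_def F_def add_edge_def del_edge_def)
  show ?thesis
  proof
    assume "t_switch a b c d T"
    then have inter: "interchangeable a b c d T" and "all_bridges (parcs T')"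
      by (auto simp: t_switch_def two_switch_def undirected_tree_iff T'_def)
    \<comment> \<open>\<open>ac\<close> is a bridge of \<open>T'\<close>, and \<open>F\<close> does
      not contain it because it is not an edge of \<open>T\<close>.\<close>
    have "(a, c) \<notin> F\<^sup>*"
      by (rule all_bridgesD[OF \<open>all_bridges (parcs T')\<close>])
        (use inter in \<open>auto simp: T' F_def interchangeable_def dest: arcs_symmetric\<close>)
    moreover have "(b, d) \<notin> F\<^sup>*"
      by (rule all_bridgesD[OF \<open>all_bridges (parcs T')\<close>])
        (use inter in \<open>auto simp: T' F_def interchangeable_def dest: arcs_symmetric\<close>)
    ultimately show "(b, c) \<in> F\<^sup>* \<or> (a, d) \<in> F\<^sup>*" using cross by blast
  next
    assume joined: "(b, c) \<in> F\<^sup>* \<or> (a, d) \<in> F\<^sup>*"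
    have nab: "(a, b) \<notin> F\<^sup>*" and ncd: "(c, d) \<notin> F\<^sup>*"
      and not_both: "\<not> ((a, d) \<in> F\<^sup>* \<and> (b, c) \<in> F\<^sup>*)"
      using ab cd sym[of b c] unfolding rtrancl_Un_edge by blast+
    \<comment> \<open>Together with \<open>b\<close>, \<open>c\<close> joined this would join
      \<open>a\<close>, \<open>b\<close>; together with \<open>a\<close>, \<open>d\<close> joined it
      would join \<open>c\<close>, \<open>d\<close>.\<close>
    have ac: "(a, c) \<notin> F\<^sup>*"
      using joined nab ncd sym[of b c] sym[of a c] trans[of a c b] trans[of c a d] by blast
    have "(b, d) \<notin> F\<^sup>*"
      using joined nab ncd sym[of b d] sym[of b c] trans[of a d b] trans[of c b d] by blast
    \<comment> \<open>Crossing \<open>ac\<close> on the way from \<open>b\<close> to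
      \<open>d\<close> means either that \<open>F\<close> joins \<open>b\<close>, \<open>a\<close>,
      or that it joins both \<open>b\<close>, \<open>c\<close> and \<open>a\<close>,
      \<open>d\<close>.\<close>
    then have bd: "(b, d) \<notin> (F \<union> edge a c)\<^sup>*"
      using nab not_both sym[of b a] unfolding rtrancl_Un_edge by blast
    \<comment> \<open>Interchangeability is derived here: \<open>ac\<close> and \<open>bd\<close>
      are outside \<open>F\<close>, and by disjointness they differ from the two deleted
      edges.\<close>
    from ac \<open>(b, d) \<notin> F\<^sup>*\<close> have "(a, c) \<notin> F" "(b, d) \<notin> F" by auto
    then have inter: "interchangeable a b c d T"
      using assms by (auto simp: interchangeable_def F_def)
    have "pair_graph T'"
      unfolding T'_def using assms verts
      by (intro pair_graph_add_edge pair_graph_del_edge pair_graph)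
        (auto simp: add_edge_def del_edge_def)
    moreover have "all_bridges (parcs T')"
      unfolding T'
    proof (intro all_bridges_Un_edge ac bd symF)
      show "all_bridges F" using bridges by (rule all_bridges_mono) (auto simp: F_def)
      show "sym (F \<union> edge a c)" by (intro sym_Un symF) (auto simp: sym_def)
    qed
    moreover have "(u, v) \<in> (parcs T')\<^sup>*" if "u \<in> pverts T" "v \<in> pverts T" for u v
    proof -
      let ?R = "(parcs T')\<^sup>*"
      have "sym (parcs T')" unfolding T' by (intro sym_Un symF) (auto simp: sym_def)
      note symR = sym_rtranclD[OF this]
      have F: "F\<^sup>* \<subseteq> ?R" unfolding T' by (rule rtrancl_mono) auto
      have ac: "(a, c) \<in> ?R" and bd: "(b, d) \<in> ?R" unfolding T' by auto
      \<comment> \<open>The route is \<open>a\<close>, \<open>c\<close>, then \<open>b\<close>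
        within \<open>F\<close>, or \<open>a\<close>, then \<open>d\<close> within \<open>F\<close>,
        then \<open>b\<close>. Thus \<open>a\<close> reaches all four entries, and from them every
        vertex.\<close>
      have "(a, b) \<in> ?R"
        using joined
      proof
        assume "(b, c) \<in> F\<^sup>*"
        then have "(c, b) \<in> ?R" using F symR by blast
        with ac show ?thesis by (rule rtrancl_trans)
      next
        assume "(a, d) \<in> F\<^sup>*"
        then have "(a, d) \<in> ?R" using F by blast
        then show ?thesis using symR[OF bd] by (rule rtrancl_trans)
      qed
      moreover from this bd have "(a, d) \<in> ?R" by (rule rtrancl_trans)
      ultimately have "(a, w) \<in> ?R" if "w \<in> pverts T" for w
        using reach[OF that] F ac by (blast intro: rtrancl_trans[of a _ "parcs T'"])
      then have "(u, a) \<in> ?R" "(a, v) \<in> ?R" using that symR by blast+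
      then show ?thesis by (rule rtrancl_trans)
    qed
    ultimately have "undirected_tree T'"
      unfolding undirected_tree_iff T'(1) using verts by blast
    then show "t_switch a b c d T"
      using assms(1) inter by (simp add: t_switch_def two_switch_def T'_def)
  qed
qed

theorem theorem3:
  fixes T :: "'a pair_pre_digraph" and a b c d :: 'a
  assumes "undirected_tree T"
    and "(a, b) \<in> parcs T" and "(c, d) \<in> parcs T" and "{a, b} \<inter> {c, d} = {}"
  shows "t_switch a b c d T \<longleftrightarrow>
    (\<exists>q. the_path T a d = [a, b] @ q @ [c, d]) \<or>
    (\<exists>q. the_path T b c = [b, a] @ q @ [d, c])"
proof -
  interpret pair_graph T using assms(1) by (simp add: undirected_tree_def)
  \<comment> \<open>The second form is the first one with both rows of the matrix reversed, which
    deletes the same two edges.\<close>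
  have "(\<exists>q. the_path T b c = [b, a] @ q @ [d, c]) \<longleftrightarrow>
      (a, d) \<in> (parcs T - edge b a - edge d c)\<^sup>*"
    using assms arcs_symmetric by (intro the_path_form_iff) auto
  moreover have "parcs T - edge b a - edge d c = parcs T - edge a b - edge c d" by auto
  ultimately show ?thesis
    unfolding t_switch_iff[OF assms] the_path_form_iff[OF assms] by (simp only:)
qed

end
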